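(* There exists no scattering algorithm using only global weak multiplicity detection whose expected number of rounds is $O(1)$; that is, there is no such algorithm $\mathcal{A}$ and constant $E$ such that for every $n$, every configuration of $n$ robots is scattered by $\mathcal{A}$ in at most $E$ rounds in expectation.
   Context: Mobile robot model: robots are points in the plane; anonymous, oblivious, disoriented; fully synchronous rounds in which every robot Looks (snapshot of positions), Computes a destination (possibly randomly) and Moves toward it. A configuration is the multiset of robot positions; it is scattered when no two robots share a position. With global weak multiplicity detection, a robot's snapshot shows the set of occupied points and, for each, whether it holds one robot or more than one, but not the number of robots there; in particular robots do not know the total number $n$ of robots. Time is measured in rounds.
   Formalization: Algorithms are restricted to choosing, for each snapshot, among finitely many destinations (any number, any probabilities); without this the claim is false, since a destination drawn uniformly from a disc almost surely scatters all robots in one round. *)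

theory Defs
  imports "HOL-Probability.Probability"
begin

type_synonym point = "real^2"

type_synonym weak_snapshot = "(point \<times> bool) set"

text \<open>
  Weak multiplicity: the flag of an occupied point tells whether it holds more than one robot.
\<close>

definition weak_snapshot :: "point multiset \<Rightarrow> weak_snapshot" where
  "weak_snapshot M = (\<lambda>p. (p, count M p > 1)) ` set_mset M"

definition scattered :: "point multiset \<Rightarrow> bool" where
  "scattered M \<longleftrightarrow> (\<forall>p. count M p \<le> 1)"

text \<open>
  Robots are named by the numbers below \<open>n\<close>. The names serve the analysis only:
  an algorithm never sees them, nor \<open>n\<close>. Values of a placement outside \<open>{..<n}\<close> are irrelevant.
\<close>

type_synonym placement = "nat \<Rightarrow> point"

definition configuration :: "nat \<Rightarrow> placement \<Rightarrow> point multiset" where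
  "configuration n P = image_mset P (mset_set {..<n})"

text \<open>
  An algorithm sends the current snapshot, in local coordinates with the observing robot
  at the origin, to the distribution of the destination, in the same coordinates.
  Being one function of the snapshot, it is anonymous and oblivious.

  Each computation is a choice among finitely many destinations, as when it uses a finite
  number of random bits. This number may depend on the snapshot in an arbitrary way, and the
  choice need not be uniform. Some such restriction is implicit in the model: with a continuous
  distribution, for example the uniform one on a disc, all robots are almost surely separated
  after a single round, whatever the snapshot. Countable support would not be enough either:
  with a heavy-tailed distribution the number of occupied points after one round would reveal
  a lower bound on \<open>n\<close> large enough to scatter in a bounded expected number of rounds.
\<close>

type_synonym algorithm = "weak_snapshot \<Rightarrow> point pmf"

definition finite_choice :: "algorithm \<Rightarrow> bool" where
  "finite_choice A \<longleftrightarrow> (\<forall>V. finite V \<longrightarrow> finite (set_pmf (A V)))"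

text \<open>
  A local coordinate system is given by the linear map from local coordinates
  to global displacements: arbitrary axes, handedness and unit of length.
\<close>

definition local_frame :: "(point \<Rightarrow> point) \<Rightarrow> bool" where
  "local_frame f \<longleftrightarrow> (\<exists>c>0. \<exists>g. orthogonal_transformation g \<and> f = (\<lambda>x. c *\<^sub>R g x))"

definition destination ::
  "algorithm \<Rightarrow> (point \<Rightarrow> point) \<Rightarrow> point multiset \<Rightarrow> point \<Rightarrow> point pmf" where
  "destination A f M p =
     map_pmf (\<lambda>d. p + f d) (A (weak_snapshot (image_mset (\<lambda>q. inv f (q - p)) M)))"

text \<open>
  \<open>mv t i p q\<close> is the point where robot \<open>i\<close> ends in round \<open>t\<close> when moving from \<open>p\<close>
  towards \<open>q\<close>. It may be stopped early, but not before having travelled the distance \<open>\<delta>\<close>.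
  For \<open>\<delta> = \<infinity>\<close> every robot reaches its destination.
\<close>

definition admissible_moves :: "ennreal \<Rightarrow> (nat \<Rightarrow> nat \<Rightarrow> point \<Rightarrow> point \<Rightarrow> point) \<Rightarrow> bool" where
  "admissible_moves \<delta> mv \<longleftrightarrow>
     (\<forall>t i p q. mv t i p q \<in> closed_segment p q \<and>
        (mv t i p q = q \<or> \<delta> \<le> ennreal (dist p (mv t i p q))))"

text \<open>One fully synchronous round; the robots draw their destinations independently.\<close>

definition round_pmf ::
  "algorithm \<Rightarrow> (nat \<Rightarrow> point \<Rightarrow> point) \<Rightarrow> (nat \<Rightarrow> nat \<Rightarrow> point \<Rightarrow> point \<Rightarrow> point) \<Rightarrow> nat \<Rightarrow>
    nat \<Rightarrow> placement \<Rightarrow> placement pmf" where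
  "round_pmf A frame mv n t P =
     Pi_pmf {..<n} 0
       (\<lambda>i. map_pmf (mv t i (P i)) (destination A (frame i) (configuration n P) (P i)))"

text \<open>
  The law on \<open>nat \<Rightarrow> 's\<close> of the Markov chain with initial state \<open>s\<close> and transition
  \<open>K t\<close> from time \<open>t\<close> to time \<open>t + 1\<close>, where every state space carries the discrete
  \<open>\<sigma>\<close>-algebra.
\<close>

definition chain_kernel :: "(nat \<Rightarrow> 's \<Rightarrow> 's pmf) \<Rightarrow> 's \<Rightarrow> nat \<Rightarrow> (nat \<Rightarrow> 's) \<Rightarrow> 's measure" where
  "chain_kernel K s t \<omega> =
     measure_pmf (case t of 0 \<Rightarrow> return_pmf s | Suc u \<Rightarrow> K u (\<omega> u))"

lemma Ionescu_Tulcea_chain_kernel: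
  "Ionescu_Tulcea (chain_kernel K s) (\<lambda>_. count_space UNIV)"
proof (rule Ionescu_Tulcea.intro)
  fix t :: nat
  show "chain_kernel K s t \<in>
      measurable (PiM {0..<t} (\<lambda>_. count_space UNIV)) (subprob_algebra (count_space UNIV))"
  proof (cases t)
    case 0
    then show ?thesis
      by (auto simp: chain_kernel_def[abs_def] space_subprob_algebra
            intro: measure_pmf.subprob_space_axioms)
  next
    case (Suc u)
    have "(\<lambda>\<omega>. \<omega> u) \<in>
        measurable (PiM {0..<t} (\<lambda>_. count_space UNIV :: 'a measure)) (count_space UNIV)"
      using Suc by (intro measurable_component_singleton) auto
    moreover have "(\<lambda>x. measure_pmf (K u x)) \<in>
        measurable (count_space UNIV) (subprob_algebra (count_space UNIV))"
      by (auto simp: space_subprob_algebra intro: measure_pmf.subprob_space_axioms)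
    ultimately show ?thesis
      using Suc by (simp add: chain_kernel_def[abs_def])
  qed
qed (simp add: chain_kernel_def prob_space_measure_pmf)

definition chain_measure :: "(nat \<Rightarrow> 's \<Rightarrow> 's pmf) \<Rightarrow> 's \<Rightarrow> (nat \<Rightarrow> 's) measure" where
  "chain_measure K s =
     projective_family.lim UNIV
       (Ionescu_Tulcea.CI (chain_kernel K s) (\<lambda>_. count_space UNIV)) (\<lambda>_. count_space UNIV)"

text \<open>Number of rounds until the first scattered configuration, \<open>\<infinity>\<close> if there is none.\<close>

definition rounds_to_scatter :: "nat \<Rightarrow> (nat \<Rightarrow> placement) \<Rightarrow> ennreal" where
  "rounds_to_scatter n \<omega> = (INF t\<in>{t. scattered (configuration n (\<omega> t))}. of_nat t)"

definition expected_rounds ::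
  "algorithm \<Rightarrow> (nat \<Rightarrow> point \<Rightarrow> point) \<Rightarrow> (nat \<Rightarrow> nat \<Rightarrow> point \<Rightarrow> point \<Rightarrow> point) \<Rightarrow> nat \<Rightarrow>
    placement \<Rightarrow> ennreal" where
  "expected_rounds A frame mv n P =
     (\<integral>\<^sup>+ \<omega>. rounds_to_scatter n \<omega> \<partial>chain_measure (round_pmf A frame mv n) P)"

text \<open>The bound must hold against every choice of local frames and of early stops.\<close>

definition scatters_within :: "ennreal \<Rightarrow> algorithm \<Rightarrow> real \<Rightarrow> nat \<Rightarrow> placement \<Rightarrow> bool" where
  "scatters_within \<delta> A E n P \<longleftrightarrow>
     (\<forall>frame mv. (\<forall>i<n. local_frame (frame i)) \<and> admissible_moves \<delta> mv \<longrightarrow>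
        expected_rounds A frame mv n P \<le> ennreal E)"

end

theory Submission
  imports Defs
begin

text \<open>
  Start with all robots at one point, and let all frames be the identity and all moves be
  complete. As long as every occupied point holds at least two robots, the snapshots do not
  depend on how many robots there are, so the set of points that the robots may choose is a
  finite set \<open>S t\<close> determined by the algorithm alone. If every point of \<open>S t\<close> holds
  sufficiently many robots, then with probability close to 1 every point of \<open>S (t + 1)\<close> is
  chosen by as many robots as desired. Going backwards from round \<open>T\<close>, one finds a number
  of robots for which, with probability at least 1/2, no configuration up to round \<open>T\<close> is scattered;
  and \<open>T\<close> is arbitrary.
\<close>

section \<open>Staying probabilities of Markov chains\<close>

text \<open>The event constrains only the times up to \<open>T\<close>, so the finite marginal
  \<open>C 0 (Suc T)\<close> computes its mass; there every transition keeps at least the fraction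
  \<open>c\<close> of the mass.\<close>

lemma emeasure_chain_measure_ge:
  fixes K :: "nat \<Rightarrow> 's \<Rightarrow> 's pmf" and c :: ennreal
  assumes start: "s \<in> G 0"
    and step: "\<And>t x. t < T \<Longrightarrow> x \<in> G t \<Longrightarrow> c \<le> emeasure (K t x) (G (Suc t))"
  defines "X \<equiv> {\<omega>. \<forall>t\<le>T. \<omega> t \<in> G t}"
  shows "X \<in> sets (chain_measure K s)" and "c ^ T \<le> emeasure (chain_measure K s) X"
proof -
  interpret Ionescu_Tulcea "chain_kernel K s" "\<lambda>_. count_space UNIV"
    by (rule Ionescu_Tulcea_chain_kernel)
  define Y where "Y n = (\<Pi>\<^sub>E i\<in>{0..<n}. G i)" for n :: nat
  have Y[measurable]: "Y n \<in> sets (PiM {0..<n} (\<lambda>_. count_space UNIV))" for n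
    unfolding Y_def by (intro sets_PiM_I_finite) auto
  have X: "X = prod_emb UNIV (\<lambda>_. count_space UNIV) {0..<Suc T} (Y (Suc T))"
    unfolding X_def Y_def
    by (subst prod_emb_PiE) (auto simp: PiE_iff less_Suc_eq_le split: if_splits)
  then show "X \<in> sets (chain_measure K s)"
    by (simp add: chain_measure_def PF.sets_lim)
  \<comment> \<open>For \<open>n > 0\<close>, \<open>C 0 n\<close> is the law of the first
    \<open>n\<close> states, which involve only \<open>n - 1\<close> transitions; the initial state
    lies in \<open>G 0\<close> and costs nothing.\<close>
  have "c ^ (n - 1) \<le> emeasure (C 0 n (\<lambda>_. undefined)) (Y n)" if "n \<le> Suc T" for n
    using that
  proof (induction n)
    case 0
    have "(\<lambda>_. undefined) \<in> Y 0"
      by (simp add: Y_def)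
    then show ?case
      using Y[of 0] by (simp add: emeasure_return)
  next
    case (Suc n)
    define b where "b = (if n = 0 then 1 else c)"
    have "b \<le> emeasure (eP n \<omega>) (Y (Suc n))" if \<omega>: "\<omega> \<in> Y n" for \<omega>
    proof -
      have sp: "\<omega> \<in> space (PiM {0..<n} (\<lambda>_. count_space UNIV))"
        using \<omega> by (auto simp: Y_def space_PiM)
      have "b \<le> emeasure (chain_kernel K s n \<omega>) (G n)"
      proof (cases n)
        case 0
        then show ?thesis
          using start by (simp add: b_def chain_kernel_def)
      next
        case (Suc m)
        then show ?thesis
          using \<omega> \<open>Suc n \<le> Suc T\<close> step[of m "\<omega> m"]
          by (simp add: b_def chain_kernel_def Y_def PiE_iff)
      qed
      \<comment> \<open>Since \<open>\<omega>\<close> already lies in \<open>Y n\<close>, only the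
        new coordinate is constrained.\<close>
      also have "G n = fun_upd \<omega> n -` Y (Suc n) \<inter> space (count_space UNIV)"
        using \<omega> by (auto simp: Y_def PiE_iff extensional_def atLeastLessThanSuc)
      also have "emeasure (chain_kernel K s n \<omega>) \<dots> = emeasure (eP n \<omega>) (Y (Suc n))"
        using sp by (rule emeasure_eP[symmetric]) (rule Y)
      finally show ?thesis .
    qed
    then have "(\<integral>\<^sup>+\<omega>. b * indicator (Y n) \<omega> \<partial>C 0 n (\<lambda>_. undefined)) \<le>
        (\<integral>\<^sup>+\<omega>. emeasure (eP n \<omega>) (Y (Suc n)) \<partial>C 0 n (\<lambda>_. undefined))"
      by (intro nn_integral_mono) (simp split: split_indicator)
    also have "\<dots> = emeasure (C 0 (Suc n) (\<lambda>_. undefined)) (Y (Suc n))"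
      using Y[of "Suc n"]
      by (simp, subst emeasure_bind[where N="PiM {0..<Suc n} (\<lambda>_. count_space UNIV)"])
         (auto simp: space_C measurable_cong_sets[OF sets_C refl])
    finally have "b * emeasure (C 0 n (\<lambda>_. undefined)) (Y n) \<le>
        emeasure (C 0 (Suc n) (\<lambda>_. undefined)) (Y (Suc n))"
      using Y[of n] by (simp add: nn_integral_cmult_indicator sets_C)
    moreover have "b * c ^ (n - 1) \<le> b * emeasure (C 0 n (\<lambda>_. undefined)) (Y n)"
      using Suc by (intro mult_left_mono) auto
    ultimately show ?case
      by (cases n) (auto simp: b_def)
  qed
  moreover have "prod_emb {0..<Suc T} (\<lambda>_. count_space UNIV) {0..<Suc T} (Y (Suc T)) = Y (Suc T)"
    by (rule prod_emb_id) (auto simp: Y_def)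
  ultimately show "c ^ T \<le> emeasure (chain_measure K s) X"
    using lim[of "{0..<Suc T}" "Y (Suc T)"] Y[of "Suc T"]
      emeasure_CI[of "{0..<Suc T}" "Suc T" "Y (Suc T)"]
    by (metis X chain_measure_def diff_Suc_1 finite_atLeastLessThan order_refl subset_refl)
qed

section \<open>Independent choices\<close>

text \<open>Cut \<open>m\<close> disjoint blocks of \<open>L\<close> indices from \<open>R\<close>.
  By independence a block misses \<open>q\<close> altogether with probability at most
  \<open>(1 - r) ^ L\<close>; if no block does, there are at least \<open>m\<close> hits. The
  induction splits off one block at a time.\<close>

lemma prob_few_hits_le:
  fixes q :: 'b and p :: "'a \<Rightarrow> 'b pmf"
  assumes I: "finite I" and "R \<subseteq> I" and "m * L \<le> card R"
    and r: "\<And>i. i \<in> R \<Longrightarrow> r \<le> pmf (p i) q"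
  shows "measure (Pi_pmf I d p) {x. card {i\<in>R. x i = q} < m} \<le> real m * (1 - r) ^ L"
  using \<open>R \<subseteq> I\<close> \<open>m * L \<le> card R\<close> r
proof (induction m arbitrary: R)
  case 0
  then show ?case by simp
next
  case (Suc m)
  have finR: "finite R"
    using Suc.prems(1) I finite_subset by blast
  obtain R1 where R1: "R1 \<subseteq> R" "card R1 = L"
    using obtain_subset_with_card_n[of L R] Suc.prems(2) by auto
  define R2 where "R2 = R - R1"
  have finR1: "finite R1"
    using R1 finR finite_subset by blast
  have "card R2 = card R - L"
    using R1 finR1 by (simp add: R2_def card_Diff_subset)
  then have IH: "measure (Pi_pmf I d p) {x. card {i\<in>R2. x i = q} < m} \<le> real m * (1 - r) ^ L"
    using Suc.prems by (intro Suc.IH) (auto simp: R2_def)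
  \<comment> \<open>Missing \<open>q\<close> on all of \<open>R1\<close> is a product event, so its
    probability factorizes.\<close>
  define B where "B i = (if i \<in> R1 then - {q} else UNIV)" for i
  have "measure (Pi_pmf I d p) (Pi I B) = (\<Prod>i\<in>I. measure (p i) (B i))"
    by (rule measure_Pi_pmf_Pi[OF I])
  also have "\<dots> = (\<Prod>i\<in>R1. measure (p i) (- {q}))"
    using R1 Suc.prems(1)
    by (intro prod.mono_neutral_cong_right I) (auto simp: B_def)
  also have "\<dots> \<le> (\<Prod>i\<in>R1. 1 - r)"
  proof (intro prod_mono conjI)
    fix i assume "i \<in> R1"
    then show "measure (p i) (- {q}) \<le> 1 - r"
      using measure_pmf.prob_compl[of "{q}" "p i"] Suc.prems(3)[of i] R1
      by (auto simp: Compl_eq_Diff_UNIV measure_pmf_single)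
  qed simp
  finally have miss: "measure (Pi_pmf I d p) (Pi I B) \<le> (1 - r) ^ L"
    by (simp add: R1)
  \<comment> \<open>One hit in \<open>R1\<close> and \<open>m\<close> hits in \<open>R2\<close>
    together make \<open>Suc m\<close> hits.\<close>
  have "{x. card {i\<in>R. x i = q} < Suc m} \<subseteq> Pi I B \<union> {x. card {i\<in>R2. x i = q} < m}"
  proof (intro subsetI, rule ccontr)
    fix x assume lt: "x \<in> {x. card {i\<in>R. x i = q} < Suc m}"
      and "x \<notin> Pi I B \<union> {x. card {i\<in>R2. x i = q} < m}"
    then have ge: "m \<le> card {i\<in>R2. x i = q}" and "x \<notin> Pi I B"
      by auto
    then obtain i where "x i \<notin> B i"
      by auto
    then have i: "i \<in> R1" "x i = q"
      by (auto simp: B_def split: if_splits)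
    have "card (insert i {i\<in>R2. x i = q}) \<le> card {i\<in>R. x i = q}"
      using i R1 finR by (intro card_mono) (auto simp: R2_def)
    then show False
      using lt ge i finR by (simp add: R2_def)
  qed
  then have "measure (Pi_pmf I d p) {x. card {i\<in>R. x i = q} < Suc m} \<le>
      measure (Pi_pmf I d p) (Pi I B \<union> {x. card {i\<in>R2. x i = q} < m})"
    by (intro measure_pmf.finite_measure_mono) auto
  also have "\<dots> \<le> measure (Pi_pmf I d p) (Pi I B) +
      measure (Pi_pmf I d p) {x. card {i\<in>R2. x i = q} < m}"
    by (intro measure_Un_le) auto
  also have "\<dots> \<le> real (Suc m) * (1 - r) ^ L"
    using miss IH by (simp add: algebra_simps)
  finally show ?case .
qed


section \<open>Crowded placements and their snapshots\<close>

text \<open>The counts after a round are random, so the invariant keeps only a lower bound on them.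
  For \<open>m > 0\<close>, \<open>S\<close> is exactly the set of occupied points.\<close>

definition crowded :: "nat \<Rightarrow> point set \<Rightarrow> nat \<Rightarrow> placement set" where
  "crowded n S m =
     {P. P ` {..<n} \<subseteq> S \<and> (\<forall>s\<in>S. m \<le> card {i\<in>{..<n}. P i = s})}"

text \<open>
  In a crowded placement every flag of the snapshot is \<^term>\<open>True\<close>, so the destination
  depends on the set \<open>S\<close> of occupied points only.
\<close>

definition crowded_destination :: "algorithm \<Rightarrow> point set \<Rightarrow> point \<Rightarrow> point pmf" where
  "crowded_destination A S p = map_pmf (\<lambda>d. p + d) (A ((\<lambda>q. (q - p, True)) ` S))"

definition next_points :: "algorithm \<Rightarrow> point set \<Rightarrow> point set" where
  "next_points A S = (\<Union>p\<in>S. set_pmf (crowded_destination A S p))"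

abbreviation exact_round :: "algorithm \<Rightarrow> nat \<Rightarrow> nat \<Rightarrow> placement \<Rightarrow> placement pmf" where
  "exact_round A \<equiv> round_pmf A (\<lambda>_ x. x) (\<lambda>_ _ _ q. q)"

lemma finite_next_points: "finite_choice A \<Longrightarrow> finite S \<Longrightarrow> finite (next_points A S)"
  by (simp add: next_points_def crowded_destination_def finite_choice_def)

lemma next_points_nonempty: "S \<noteq> {} \<Longrightarrow> next_points A S \<noteq> {}"
  by (auto simp: next_points_def set_pmf_not_empty)

lemma count_configuration: "count (configuration n P) s = card {i\<in>{..<n}. P i = s}"
proof -
  have "P -` {s} \<inter> {..<n} = {i\<in>{..<n}. P i = s}"
    by auto
  then show ?thesis
    by (simp add: configuration_def count_image_mset)
qed

lemma crowded_not_scattered: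
  assumes "P \<in> crowded n S m" "2 \<le> m" "S \<noteq> {}"
  shows "\<not> scattered (configuration n P)"
proof -
  obtain s where "s \<in> S"
    using assms by auto
  then have "2 \<le> count (configuration n P) s"
    using assms by (force simp: crowded_def count_configuration)
  then show ?thesis
    unfolding scattered_def by (metis Suc_1 not_less_eq_eq)
qed

lemma set_configuration_crowded:
  assumes "P \<in> crowded n S m" "0 < m"
  shows "set_mset (configuration n P) = S"
proof
  show "set_mset (configuration n P) \<subseteq> S"
    using assms by (auto simp: crowded_def configuration_def)
  show "S \<subseteq> set_mset (configuration n P)"
  proof
    fix s assume "s \<in> S"
    then have "0 < count (configuration n P) s"
      using assms by (fastforce simp: crowded_def count_configuration)
    then show "s \<in> set_mset (configuration n P)"
      by simp
  qed
qed

text \<open>The number of robots drops out here: translation is injective and so preserves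
  multiplicities, and two robots suffice to set a flag.\<close>

lemma weak_snapshot_crowded:
  assumes "P \<in> crowded n S m" "2 \<le> m"
  shows "weak_snapshot (image_mset (\<lambda>q. q - p) (configuration n P)) = (\<lambda>q. (q - p, True)) ` S"
proof -
  have "1 < count (image_mset (\<lambda>q. q - p) (configuration n P)) (q - p)" if "q \<in> S" for q
  proof -
    have "2 \<le> count (configuration n P) q"
      using assms that by (force simp: crowded_def count_configuration)
    also have "\<dots> = count (configuration n (\<lambda>i. P i - p)) (q - p)"
      by (simp add: count_configuration)
    also have "configuration n (\<lambda>i. P i - p) = image_mset (\<lambda>q. q - p) (configuration n P)"
      by (simp add: configuration_def image_mset.compositionality comp_def)
    finally show ?thesis
      by simp
  qed
  then show ?thesis
    using set_configuration_crowded[OF assms(1)] assms(2)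
    by (simp add: weak_snapshot_def image_image)
qed

lemma exact_round_crowded:
  assumes "P \<in> crowded n S m" "2 \<le> m"
  shows "exact_round A n t P = Pi_pmf {..<n} 0 (\<lambda>i. crowded_destination A S (P i))"
proof -
  have "inv (\<lambda>x::point. x) = (\<lambda>x. x)"
    using inv_id unfolding id_def .
  then show ?thesis
    by (simp add: round_pmf_def destination_def crowded_destination_def
        weak_snapshot_crowded[OF assms] pmf.map_ident)
qed

section \<open>Crowding from round to round\<close>

text \<open>All destinations lie in \<open>next_points A S\<close>, so only an underpopulated point
  can spoil crowding. Each \<open>q\<close> there is chosen with positive probability from some
  \<open>p\<close> in \<open>S\<close>; enough robots at \<open>p\<close> make a shortage at
  \<open>q\<close> unlikely, and a union bound over the finitely many \<open>q\<close>
  finishes.\<close>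

lemma eventually_exact_round_crowded:
  assumes A: "finite_choice A" and S: "finite S" and "0 < e"
  shows "\<forall>\<^sub>F N in sequentially. \<forall>n P t. P \<in> crowded n S N \<longrightarrow>
           1 - e \<le> measure (exact_round A n t P) (crowded n (next_points A S) m)"
proof -
  let ?Q = "next_points A S"
  let ?few = "\<lambda>n q. {x. card {i\<in>{..<n}. x i = q} < m}"
  \<comment> \<open>An equal share of \<open>e\<close> for each point; \<open>+ 1\<close> avoids a
    zero denominator when \<open>?Q\<close> is empty.\<close>
  define e' where "e' = e / (card ?Q + 1)"
  have "0 < e'"
    using \<open>0 < e\<close> by (simp add: e'_def)
  have finQ: "finite ?Q"
    using A S by (rule finite_next_points)
  have "\<forall>\<^sub>F N in sequentially. \<forall>n P t. P \<in> crowded n S N \<longrightarrow>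
      measure (exact_round A n t P) (?few n q) \<le> e'" if "q \<in> ?Q" for q
  proof -
    obtain p where p: "p \<in> S" "q \<in> set_pmf (crowded_destination A S p)"
      using \<open>q \<in> ?Q\<close> by (auto simp: next_points_def)
    \<comment> \<open>\<open>r\<close> does not involve \<open>n\<close>, \<open>P\<close> or
      \<open>t\<close>, so \<open>L\<close> and the bound on \<open>N\<close> below serve all of
      them.\<close>
    define r where "r = pmf (crowded_destination A S p) q"
    have "0 < r" "r \<le> 1"
      using p(2) by (auto simp: r_def pmf_positive pmf_le_1)
    then have "(\<lambda>L. real m * (1 - r) ^ L) \<longlonglongrightarrow> real m * 0"
      by (intro tendsto_mult_left LIMSEQ_power_zero) auto
    then have "\<forall>\<^sub>F L in sequentially. real m * (1 - r) ^ L < e'"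
      using \<open>0 < e'\<close> by (intro order_tendstoD(2)) auto
    then obtain L where L: "real m * (1 - r) ^ L < e'"
      by (auto simp: eventually_sequentially)
    show ?thesis
      \<comment> \<open>\<open>2\<close> makes every flag true; \<open>m * L\<close> provides
        \<open>m\<close> blocks of \<open>L\<close> robots at \<open>p\<close>.\<close>
      using eventually_ge_at_top[of "max 2 (m * L)"]
    proof eventually_elim
      case (elim N)
      show ?case
      proof (intro allI impI)
        fix n P t assume P: "P \<in> crowded n S N"
        let ?R = "{i\<in>{..<n}. P i = p}"
        have "N \<le> card ?R"
          using P p(1) by (simp add: crowded_def)
        then have few: "measure (Pi_pmf {..<n} 0 (\<lambda>i. crowded_destination A S (P i)))
            {x. card {i\<in>?R. x i = q} < m} \<le> real m * (1 - r) ^ L"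
          using elim by (intro prob_few_hits_le) (auto simp: r_def)
        \<comment> \<open>Robots arriving from other points can only add to those coming from
          \<open>p\<close>.\<close>
        have "card {i\<in>?R. x i = q} \<le> card {i\<in>{..<n}. x i = q}" for x
          by (intro card_mono) auto
        then have "?few n q \<subseteq> {x. card {i\<in>?R. x i = q} < m}"
          by (auto intro: le_less_trans)
        then have "measure (exact_round A n t P) (?few n q) \<le>
            measure (exact_round A n t P) {x. card {i\<in>?R. x i = q} < m}"
          by (intro measure_pmf.finite_measure_mono) auto
        also have "\<dots> \<le> e'"
          using few L elim exact_round_crowded[OF P, of A t] by simp
        finally show "measure (exact_round A n t P) (?few n q) \<le> e'" .
      qed
    qed
  qed
  then have "\<forall>\<^sub>F N in sequentially. \<forall>q\<in>?Q. \<forall>n P t. P \<in> crowded n S N \<longrightarrow>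
      measure (exact_round A n t P) (?few n q) \<le> e'"
    using finQ by (simp add: eventually_ball_finite)
  then show ?thesis
    using eventually_ge_at_top[of 2]
  proof eventually_elim
    case (elim N)
    show ?case
    proof (intro allI impI)
      fix n P t assume P: "P \<in> crowded n S N"
      let ?M = "exact_round A n t P"
      have "x ` {..<n} \<subseteq> ?Q" if "x \<in> set_pmf ?M" for x
        using that set_Pi_pmf_subset'[of "{..<n}"] P elim(2)
        by (fastforce simp: exact_round_crowded[OF P] PiE_dflt_def next_points_def crowded_def)
      then have "AE x in ?M. x \<in> - crowded n ?Q m \<longrightarrow> x \<in> (\<Union>q\<in>?Q. ?few n q)"
        by (auto simp: AE_measure_pmf_iff crowded_def not_le)
      then have "measure ?M (- crowded n ?Q m) \<le> measure ?M (\<Union>q\<in>?Q. ?few n q)"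
        by (intro measure_pmf.finite_measure_mono_AE) auto
      also have "\<dots> \<le> (\<Sum>q\<in>?Q. measure ?M (?few n q))"
        using finQ by (intro measure_pmf.finite_measure_subadditive_finite) auto
      also have "\<dots> \<le> (\<Sum>q\<in>?Q. e')"
        using elim(1) P by (intro sum_mono) blast
      also have "\<dots> \<le> e"
        using \<open>0 < e\<close> by (simp add: e'_def field_simps)
      finally show "1 - e \<le> measure ?M (crowded n ?Q m)"
        using measure_pmf.prob_compl[of "crowded n ?Q m" ?M] by (simp add: Compl_eq_Diff_UNIV)
    qed
  qed
qed

text \<open>Each threshold must be large enough for the next one, so they are found from the last
  round backwards: the induction hypothesis serves the rounds starting from
  \<open>next_points A S\<close>, and a first threshold is put in front. The round index
  \<open>u\<close> is arbitrary, which makes this shift in time harmless.\<close>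

lemma crowding_thresholds:
  assumes A: "finite_choice A" and "finite S" and "0 < e"
  shows "\<exists>m. (\<forall>t\<le>T. 2 \<le> m t) \<and>
           (\<forall>t<T. \<forall>n P u. P \<in> crowded n ((next_points A ^^ t) S) (m t) \<longrightarrow>
              1 - e \<le> measure (exact_round A n u P)
                        (crowded n ((next_points A ^^ Suc t) S) (m (Suc t))))"
  using \<open>finite S\<close>
proof (induction T arbitrary: S)
  case 0
  show ?case
    by (intro exI[of _ "\<lambda>_. 2"]) auto
next
  case (Suc T)
  have "finite (next_points A S)"
    using A Suc.prems by (rule finite_next_points)
  from Suc.IH[OF this] obtain m where m: "\<forall>t\<le>T. 2 \<le> m t"
    "\<forall>t<T. \<forall>n P u. P \<in> crowded n ((next_points A ^^ t) (next_points A S)) (m t) \<longrightarrow>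
       1 - e \<le> measure (exact_round A n u P)
                 (crowded n ((next_points A ^^ Suc t) (next_points A S)) (m (Suc t)))"
    by blast
  have "\<forall>\<^sub>F N in sequentially. 2 \<le> N \<and> (\<forall>n P u. P \<in> crowded n S N \<longrightarrow>
      1 - e \<le> measure (exact_round A n u P) (crowded n (next_points A S) (m 0)))"
    by (intro eventually_conj eventually_ge_at_top eventually_exact_round_crowded
        A Suc.prems \<open>0 < e\<close>)
  then obtain N where N: "2 \<le> N" "\<forall>n P u. P \<in> crowded n S N \<longrightarrow>
      1 - e \<le> measure (exact_round A n u P) (crowded n (next_points A S) (m 0))"
    by (auto simp: eventually_sequentially)
  show ?case
  \<comment> \<open>\<open>case_nat N m\<close> is \<open>N\<close> followed by the sequence
    \<open>m\<close> delayed by one round.\<close>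
  proof (intro exI[of _ "case_nat N m"] conjI allI impI)
    show "2 \<le> case_nat N m t" if "t \<le> Suc T" for t
      using that N(1) m(1) by (cases t) auto
    show "1 - e \<le> measure (exact_round A n u P)
        (crowded n ((next_points A ^^ Suc t) S) (case_nat N m (Suc t)))"
      if "t < Suc T" "P \<in> crowded n ((next_points A ^^ t) S) (case_nat N m t)" for t n P u
      using that N(2) m(2) by (cases t) (simp_all add: funpow_swap1)
  qed
qed

section \<open>The lower bound on the expected time\<close>

lemma exact_moves_admissible: "admissible_moves \<delta> (\<lambda>_ _ _ q. q)"
  by (simp add: admissible_moves_def)

lemma identity_local_frame: "local_frame (\<lambda>x. x)"
  unfolding local_frame_def
  by (intro exI[of _ 1] conjI exI[of _ "\<lambda>x. x"]) (auto intro: orthogonal_transformation_id)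

theorem theorem4:
  fixes \<delta> :: ennreal
  assumes "\<delta> > 0"
  shows "\<not> (\<exists>(A :: algorithm) (E :: real).
            finite_choice A \<and> (\<forall>(n :: nat) (P :: placement). scatters_within \<delta> A E n P))"
proof
  assume "\<exists>(A :: algorithm) (E :: real).
    finite_choice A \<and> (\<forall>(n :: nat) (P :: placement). scatters_within \<delta> A E n P)"
  then obtain A :: algorithm and E :: real where A: "finite_choice A"
    and within: "\<And>n P. scatters_within \<delta> A E n P"
    by blast
  \<comment> \<open>Lasting \<open>T\<close> rounds with probability at least 1/2 will exceed
    \<open>E\<close>; \<open>max 0\<close> makes \<open>T\<close> positive also for negative
    \<open>E\<close>.\<close>
  obtain T :: nat where T: "max 0 (2 * E) < T"
    using reals_Archimedean2 by blast
  define S where "S t = (next_points A ^^ t) {0}" for t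
  \<comment> \<open>With this failure probability per round, Bernoulli's inequality leaves at least
    1/2 after \<open>T\<close> rounds.\<close>
  have "finite {0 :: point}" "0 < 1 / (2 * real T)"
    using T by auto
  from crowding_thresholds[OF A this]
  obtain m where m: "\<And>t. t \<le> T \<Longrightarrow> 2 \<le> m t" and
    step: "\<And>t n P u. t < T \<Longrightarrow> P \<in> crowded n (S t) (m t) \<Longrightarrow>
      1 - 1 / (2 * real T) \<le> measure (exact_round A n u P) (crowded n (S (Suc t)) (m (Suc t)))"
    unfolding S_def by metis
  \<comment> \<open>All robots start at the origin, so \<open>m 0\<close> of them just meet the
    first threshold.\<close>
  define n where "n = m 0"
  define G where "G t = crowded n (S t) (m t)" for t
  define c where "c = 1 - 1 / (2 * real T)"
  let ?M = "chain_measure (exact_round A n) (\<lambda>_. 0)"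
  let ?X = "{\<omega>. \<forall>t\<le>T. \<omega> t \<in> G t}"
  have start: "(\<lambda>_. 0) \<in> G 0"
    by (auto simp: G_def crowded_def S_def n_def)
  have "ennreal c \<le> emeasure (exact_round A n t P) (G (Suc t))" if "t < T" "P \<in> G t" for t P
    using step[of t P n t] that by (simp add: G_def c_def measure_pmf.emeasure_eq_measure ennreal_leI)
  note X = emeasure_chain_measure_ge[where G=G, OF start this]
  have "S t \<noteq> {}" for t
    by (induction t) (simp_all add: S_def next_points_nonempty)
  \<comment> \<open>Up to round \<open>T\<close> some point holds two robots. If scattering never
    happens, the infimum over the empty set is infinite.\<close>
  then have late: "of_nat T \<le> rounds_to_scatter n \<omega>" if "\<omega> \<in> ?X" for \<omega>
    unfolding rounds_to_scatter_def
  proof (intro INF_greatest)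
    fix t assume "t \<in> {t. scattered (configuration n (\<omega> t))}"
    then have "\<not> t \<le> T"
      using that m crowded_not_scattered \<open>\<And>t. S t \<noteq> {}\<close> unfolding G_def by blast
    then show "(of_nat T :: ennreal) \<le> of_nat t"
      by simp
  qed
  have "0 < real T" "0 \<le> c"
    using T by (auto simp: c_def field_simps)
  have "1 / 2 \<le> c ^ T"
    using Bernoulli_inequality[of "- 1 / (2 * real T)" T] \<open>0 < real T\<close>
    by (simp add: c_def field_simps)
  \<comment> \<open>As in Markov's inequality, the expectation is at least \<open>T\<close> times
    the probability of \<open>?X\<close>.\<close>
  have "ennreal E < ennreal (T * (1 / 2))"
    using T by (intro ennreal_lessI) auto
  also have "\<dots> \<le> ennreal (T * c ^ T)"
    using \<open>1 / 2 \<le> c ^ T\<close> by (intro ennreal_leI mult_left_mono) auto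
  also have "\<dots> = of_nat T * ennreal c ^ T"
    using \<open>0 \<le> c\<close> by (simp add: ennreal_mult ennreal_power ennreal_of_nat_eq_real_of_nat)
  also have "\<dots> \<le> of_nat T * emeasure ?M ?X"
    using X(2) by (intro mult_left_mono) auto
  also have "\<dots> = (\<integral>\<^sup>+\<omega>. of_nat T * indicator ?X \<omega> \<partial>?M)"
    using X(1) by (simp add: nn_integral_cmult_indicator)
  also have "\<dots> \<le> expected_rounds A (\<lambda>_ x. x) (\<lambda>_ _ _ q. q) n (\<lambda>_. 0)"
    unfolding expected_rounds_def
    using late by (intro nn_integral_mono) (simp split: split_indicator)
  also have "\<dots> \<le> ennreal E"
    by (rule within[unfolded scatters_within_def, rule_format])
       (simp add: identity_local_frame exact_moves_admissible)
  finally show False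
    by simp
qed

end
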